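(* For $i\in\{1,2\}$, the family $(v^i_\kappa)_{\kappa>0}$ of value functions of the perturbed problems is nonincreasing in $\kappa$, and converges pointwise on $[0,T]\times\bar{\mathcal S}$ to $v^i$ as $\kappa\downarrow0$.
   Context: Setting. $T\in(0,\infty)$; $(\Omega,\mathcal F,\mathbb P)$ is a probability space with filtration $\mathbb F=(\mathcal F_t)_{0\le t\le T}$ supporting a one-dimensional Brownian motion $W$. Constants: $\mu\in\mathbb R$, $\sigma,\lambda,\Delta,K^1,K^2>0$, $\zeta_{min}<0<\zeta_{max}$, discount factors $\rho^1,\rho^2$. $\mathcal S=(0,\infty)^3$, $\bar{\mathcal S}=[0,\infty)^3$; points are $z=(x,y^1,y^2)$. For player $i\in\{1,2\}$, $j\ne i$ is the other player, and functions of $z$ are also written as functions of $(x,y^i,y^j)$ (own price first). Wholesale price: $dX_s^{t,x}=X_s^{t,x}(\mu\,ds+\sigma\,dW_s)$ for $s\in[t,T]$, $X_s^{t,x}=x$ for $s\le t$. A strategy of player $i$ is $\alpha^i=(\tau^i_n,\zeta^i_n)_{n\ge1}$ (finite or infinite) with $\mathbb F$-stopping times $t\le\tau_1^i\le\tau_2^i\le\dots<T$ and $\mathcal F_{\tau_n^i}$-measurable $\zeta_n^i\in[\zeta_{min},\zeta_{max}]$. The price $Y^i$ starts from $Y^i_{t^-}=y^i$, is constant between the $\tau^i_n$, and $Y^i_{\tau_n^i}=\Gamma^i(Y^i_{\tau_n^{i-}},\zeta_n^i)$ with $\Gamma^i(y,\zeta)=ye^{\lambda\zeta}$. State process: $Z^{t,z,\alpha^i,\alpha^j}=(X,Y^1,Y^2)$.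 Gain of player $i$: $$J^i(t,z,\alpha^i,\alpha^j)=\mathbb E\Big[\int_t^Te^{-\rho^i(s-t)}f^i(Z_s)ds-\sum_{t\le\tau_k^i<T}e^{-\rho^i(\tau_k^i-t)}\phi^i(Y^i_{\tau_k^{i-}},\zeta_k^i)+e^{-\rho^i(T-t)}g^i(Z_T)\Big],$$ with $f^i(x,y^i,y^j)=g^i(x,y^i,y^j)=\min\{(y^i-x)\pi^i(y^i,y^j),K^ix\}$, where $\pi^i(y^i,y^j)=1$ if $y^i-y^j\le-\Delta$, $=-\frac1{2\Delta}(y^i-y^j-\Delta)$ if $-\Delta<y^i-y^j<\Delta$, $=0$ if $y^i-y^j\ge\Delta$. Standing assumption on the costs $\phi^i:\mathbb R_+\times[\zeta_{min},\zeta_{max}]\to\mathbb R$: each $\phi^i$ is continuous, and there are constants $C_1^\phi,C_2^\phi>0$ with $C_1^\phi\le\phi^i\le C_2^\phi$. Admissible strategies: $\mathcal A^i_t$ is the set of $\alpha^i$ with $\tau^i_1\ge t$, $\alpha^i$ independent of $\mathcal F_t$, and $\alpha^i\in\mathcal D^i_t$, where $\mathcal D^i_t$ is the set of strategies such that the number of interventions $\mathcal N_t(\alpha^i)=\mathrm{Card}\{n:t\le\tau_n^i<T\}$ is uniformly integrable; this condition is understood uniformly over strategies, so that in particular $\sup_{\alpha^i\in\mathcal D^i_t}\mathbb E[\mathcal N_t(\alpha^i)]<\infty$. Value functions: $v^i(t,z)=\sup_{\alpha^i\in\mathcal A^i_t}J^i(t,z,\alpha^i,\alpha^j)$, where $\alpha^j$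 is the best response against $\alpha^i$ (i.e. $\alpha^j$ maximizes player $j$'s gain over $\mathcal A_t^j$ given $\alpha^i$). Perturbed problem: for $\kappa>0$, $$J^i_\kappa(t,z,\alpha^i,\alpha^j)=J^i(t,z,\alpha^i,\alpha^j)-\kappa\,\mathbb E\Big[\sum_{t\le\tau_k^j<T}e^{-\rho^i(\tau_k^j-t)}\Big],\qquad v^i_\kappa(t,z)=\sup_{\alpha^i\in\mathcal A_t^i}J^i_\kappa(t,z,\alpha^i,\alpha^j),$$ with $\alpha^j$ the best response against $\alpha^i$. *)

theory Defs
  imports "HOL-Probability.Probability"
begin

section \<open>Brownian motion, stochastic integral, wholesale price\<close>

text \<open>
  Filtrations are the library's filtrations, indexed by all real times; only the part over \<open>{0..T}\<close>
  is used. This loses nothing: extend a filtration on \<open>{0..T}\<close> to be constant on both sides.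
\<close>

definition brownian_motion ::
    "'a measure \<Rightarrow> (real \<Rightarrow> 'a measure) \<Rightarrow> real \<Rightarrow> (real \<Rightarrow> 'a \<Rightarrow> real) \<Rightarrow> bool" where
  "brownian_motion M F T W \<longleftrightarrow>
     (\<forall>t\<in>{0..T}. W t \<in> borel_measurable (F t)) \<and>
     (AE \<omega> in M. W 0 \<omega> = 0) \<and>
     (\<forall>\<omega>\<in>space M. continuous_on {0..T} (\<lambda>t. W t \<omega>)) \<and>
     (\<forall>s t. 0 \<le> s \<and> s < t \<and> t \<le> T \<longrightarrow>
        distributed M lborel (\<lambda>\<omega>. W t \<omega> - W s \<omega>) (\<lambda>u. ennreal (normal_density 0 (sqrt (t - s)) u)) \<and>
        prob_space.indep_set M (sets (F s))
          (sets (vimage_algebra (space M) (\<lambda>\<omega>. W t \<omega> - W s \<omega>) borel)))"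

text \<open>
  A simple process on \<open>(a, b]\<close> is given by grid points \<open>p 0, ..., p m\<close> and heights \<open>\<xi> k\<close> on
  \<open>(p k, p (k + 1)]\<close>. The Ito integral is the mean-square limit of the integrals of simple
  processes approximating the integrand in mean square.
\<close>

definition simple_process ::
    "'a measure \<Rightarrow> (real \<Rightarrow> 'a measure) \<Rightarrow> real \<Rightarrow> real \<Rightarrow> nat \<Rightarrow> (nat \<Rightarrow> real) \<Rightarrow> (nat \<Rightarrow> 'a \<Rightarrow> real) \<Rightarrow> bool"
  where
  "simple_process M F a b m p \<xi> \<longleftrightarrow>
     p 0 = a \<and> p m = b \<and>
     (\<forall>k<m. p k \<le> p (Suc k) \<and> \<xi> k \<in> borel_measurable (F (p k)) \<and>
            (\<exists>C. \<forall>\<omega>\<in>space M. \<bar>\<xi> k \<omega>\<bar> \<le> C))"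

definition simple_process_at ::
    "nat \<Rightarrow> (nat \<Rightarrow> real) \<Rightarrow> (nat \<Rightarrow> 'a \<Rightarrow> real) \<Rightarrow> real \<Rightarrow> 'a \<Rightarrow> real" where
  "simple_process_at m p \<xi> r \<omega> = (\<Sum>k<m. \<xi> k \<omega> * indicator {p k<..p (Suc k)} r)"

definition simple_ito_integral ::
    "(real \<Rightarrow> 'a \<Rightarrow> real) \<Rightarrow> nat \<Rightarrow> (nat \<Rightarrow> real) \<Rightarrow> (nat \<Rightarrow> 'a \<Rightarrow> real) \<Rightarrow> 'a \<Rightarrow> real" where
  "simple_ito_integral W m p \<xi> \<omega> = (\<Sum>k<m. \<xi> k \<omega> * (W (p (Suc k)) \<omega> - W (p k) \<omega>))"

definition has_ito_integral ::
    "'a measure \<Rightarrow> (real \<Rightarrow> 'a measure) \<Rightarrow> (real \<Rightarrow> 'a \<Rightarrow> real) \<Rightarrow> real \<Rightarrow> real \<Rightarrow>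
     (real \<Rightarrow> 'a \<Rightarrow> real) \<Rightarrow> ('a \<Rightarrow> real) \<Rightarrow> bool" where
  "has_ito_integral M F W a b H I \<longleftrightarrow>
     I \<in> borel_measurable M \<and>
     (\<exists>m p \<xi>. (\<forall>n. simple_process M F a b (m n) (p n) (\<xi> n)) \<and>
       (\<lambda>n. \<integral>\<^sup>+\<omega>. (\<integral>\<^sup>+r\<in>{a..b}. ennreal ((simple_process_at (m n) (p n) (\<xi> n) r \<omega> - H r \<omega>)\<^sup>2) \<partial>lborel) \<partial>M)
          \<longlonglongrightarrow> 0 \<and>
       (\<lambda>n. \<integral>\<^sup>+\<omega>. ennreal ((simple_ito_integral W (m n) (p n) (\<xi> n) \<omega> - I \<omega>)\<^sup>2) \<partial>M) \<longlonglongrightarrow> 0)"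

text \<open>
  \<open>X\<close> solves \<open>dX = X (\<mu> ds + \<sigma> dW)\<close> on \<open>[t, T]\<close>, with \<open>X = x\<close> up to time \<open>t\<close>.
\<close>

definition wholesale_sde ::
    "'a measure \<Rightarrow> (real \<Rightarrow> 'a measure) \<Rightarrow> (real \<Rightarrow> 'a \<Rightarrow> real) \<Rightarrow> real \<Rightarrow> real \<Rightarrow> real \<Rightarrow>
     real \<Rightarrow> real \<Rightarrow> (real \<Rightarrow> 'a \<Rightarrow> real) \<Rightarrow> bool" where
  "wholesale_sde M F W T \<mu> \<sigma> t x X \<longleftrightarrow>
     (\<forall>s\<in>{0..T}. X s \<in> borel_measurable (F s)) \<and>
     (\<forall>\<omega>\<in>space M. continuous_on {0..T} (\<lambda>s. X s \<omega>)) \<and>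
     (\<forall>s\<in>{0..t}. \<forall>\<omega>\<in>space M. X s \<omega> = x) \<and>
     (\<forall>s\<in>{t..T}. \<exists>I. has_ito_integral M F W t s (\<lambda>r \<omega>. \<sigma> * X r \<omega>) I \<and>
        (AE \<omega> in M. X s \<omega> = x + (LINT r:{t..s}|lborel. \<mu> * X r \<omega>) + I \<omega>))"


section \<open>The model\<close>

datatype player = Player1 | Player2

fun other :: "player \<Rightarrow> player" where
  "other Player1 = Player2"
| "other Player2 = Player1"

text \<open>
  A strategy is a pair \<open>(\<tau>, \<zeta>)\<close> of sequences, with \<open>\<tau> n\<close> and \<open>\<zeta> n\<close> the time and the impulse of the
  \<open>(n + 1)\<close>-st intervention. Only indices with \<open>\<tau> n < T\<close> are interventions; a sequence that is
  finite (in a scenario \<open>\<omega>\<close>) is continued by \<open>\<tau> n \<omega> = T\<close>.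
\<close>

type_synonym 'a strategy = "(nat \<Rightarrow> 'a \<Rightarrow> real) \<times> (nat \<Rightarrow> 'a \<Rightarrow> real)"

text \<open>
  A state \<open>z = (x, y\<^sup>1, y\<^sup>2)\<close> is given by \<open>x\<close> and a function \<open>y\<close> on the players. The field
  \<open>wholesale\<close> is the family \<open>X\<^sup>t\<^sup>,\<^sup>x\<^sub>s\<close>, with arguments \<open>t x s \<omega>\<close>, and \<open>ui_class i t\<close> is the
  set called \<open>D\<close> (for player \<open>i\<close> and time \<open>t\<close>) in the definition of admissibility.
\<close>

record 'a duopoly =
  prob_sp :: "'a measure"
  filt :: "real \<Rightarrow> 'a measure"
  bm :: "real \<Rightarrow> 'a \<Rightarrow> real"
  horizon :: real
  drift :: real
  vol :: real
  wholesale :: "real \<Rightarrow> real \<Rightarrow> real \<Rightarrow> 'a \<Rightarrow> real"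
  elast :: real  \<comment> \<open>\<open>\<lambda>\<close>\<close>
  spread :: real  \<comment> \<open>\<open>\<Delta>\<close>\<close>
  cap :: "player \<Rightarrow> real"  \<comment> \<open>\<open>K\<close>\<close>
  zeta_min :: real
  zeta_max :: real
  discount :: "player \<Rightarrow> real"  \<comment> \<open>\<open>\<rho>\<close>\<close>
  cost :: "player \<Rightarrow> real \<Rightarrow> real \<Rightarrow> real"  \<comment> \<open>\<open>\<phi>\<close>, with arguments price, impulse\<close>
  ui_class :: "player \<Rightarrow> real \<Rightarrow> 'a strategy set"

definition strategies :: "'a duopoly \<Rightarrow> real \<Rightarrow> 'a strategy set" where
  "strategies G t = {(\<tau>, \<zeta>). \<forall>n.
     stopping_time (filt G) (\<tau> n) \<and>
     \<zeta> n \<in> borel_measurable (filtration.pre_sigma (space (prob_sp G)) (filt G) (\<tau> n)) \<and>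
     (\<forall>\<omega>\<in>space (prob_sp G). t \<le> \<tau> n \<omega> \<and> \<tau> n \<omega> \<le> \<tau> (Suc n) \<omega> \<and> \<tau> n \<omega> \<le> horizon G \<and>
        \<zeta> n \<omega> \<in> {zeta_min G..zeta_max G})}"

definition interventions :: "'a duopoly \<Rightarrow> real \<Rightarrow> 'a strategy \<Rightarrow> 'a \<Rightarrow> nat set" where
  "interventions G t \<alpha> \<omega> = {n. t \<le> fst \<alpha> n \<omega> \<and> fst \<alpha> n \<omega> < horizon G}"

definition num_interventions :: "'a duopoly \<Rightarrow> real \<Rightarrow> 'a strategy \<Rightarrow> 'a \<Rightarrow> ennreal" where
  "num_interventions G t \<alpha> \<omega> = emeasure (count_space UNIV) (interventions G t \<alpha> \<omega>)"

definition uniformly_integrable :: "'a measure \<Rightarrow> ('a \<Rightarrow> ennreal) set \<Rightarrow> bool" where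
  "uniformly_integrable M S \<longleftrightarrow>
     S \<subseteq> borel_measurable M \<and>
     (\<forall>\<epsilon>>0. \<exists>c::real. \<forall>N\<in>S. (\<integral>\<^sup>+\<omega>\<in>{\<omega>. ennreal c \<le> N \<omega>}. N \<omega> \<partial>M) \<le> ennreal \<epsilon>)"

text \<open>
  Uniform integrability of the number of interventions, uniformly over strategies, is a property of
  the family \<open>ui_class G i t\<close> as a whole and does not single out one set of strategies. So the model
  contains, as data, an arbitrary family with this property.
\<close>

definition duopoly :: "'a duopoly \<Rightarrow> bool" where
  "duopoly G \<longleftrightarrow>
     prob_space (prob_sp G) \<and>
     filtration (space (prob_sp G)) (filt G) \<and>
     (\<forall>t. subalgebra (prob_sp G) (filt G t)) \<and>
     0 < horizon G \<and>
     brownian_motion (prob_sp G) (filt G) (horizon G) (bm G) \<and>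
     0 < vol G \<and> 0 < elast G \<and> 0 < spread G \<and> (\<forall>i. 0 < cap G i) \<and>
     zeta_min G < 0 \<and> 0 < zeta_max G \<and>
     (\<forall>t\<in>{0..horizon G}. \<forall>x\<ge>0.
        wholesale_sde (prob_sp G) (filt G) (bm G) (horizon G) (drift G) (vol G) t x (wholesale G t x)) \<and>
     (\<forall>i. continuous_on ({0..} \<times> {zeta_min G..zeta_max G}) (\<lambda>(p, u). cost G i p u)) \<and>
     (\<exists>C1>0. \<exists>C2>0. \<forall>i. \<forall>p\<ge>0. \<forall>u\<in>{zeta_min G..zeta_max G}. C1 \<le> cost G i p u \<and> cost G i p u \<le> C2) \<and>
     (\<forall>i. \<forall>t\<in>{0..horizon G}. ui_class G i t \<subseteq> strategies G t \<and>
        uniformly_integrable (prob_sp G) (num_interventions G t ` ui_class G i t))"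

definition admissible :: "'a duopoly \<Rightarrow> player \<Rightarrow> real \<Rightarrow> 'a strategy set" where
  "admissible G i t = {\<alpha> \<in> ui_class G i t.
     prob_space.indep_set (prob_sp G) (sets (filt G t))
       (sets (vimage_algebra (space (prob_sp G)) (\<lambda>\<omega> n. (fst \<alpha> n \<omega>, snd \<alpha> n \<omega>))
          (PiM UNIV (\<lambda>_. borel :: (real \<times> real) measure))))}"


section \<open>Prices and gains\<close>

definition impulse :: "'a duopoly \<Rightarrow> real \<Rightarrow> real \<Rightarrow> real" where
  "impulse G p u = p * exp (elast G * u)"

text \<open>
  \<open>price_after G \<alpha> p \<omega> n\<close> is the price after \<open>n\<close> interventions. Interventions at the same time are
  carried out one after the other, so the price just before the intervention with index \<open>n\<close> is
  \<open>price_after G \<alpha> p \<omega> n\<close>, also if an earlier one happens at the same time.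
\<close>

primrec price_after :: "'a duopoly \<Rightarrow> 'a strategy \<Rightarrow> real \<Rightarrow> 'a \<Rightarrow> nat \<Rightarrow> real" where
  "price_after G \<alpha> p \<omega> 0 = p"
| "price_after G \<alpha> p \<omega> (Suc n) = impulse G (price_after G \<alpha> p \<omega> n) (snd \<alpha> n \<omega>)"

text \<open>
  The number of interventions of an admissible strategy is almost surely finite; the values on the
  remaining null set, where \<open>card\<close> and finite sums give \<open>0\<close>, are irrelevant.
\<close>

definition price :: "'a duopoly \<Rightarrow> real \<Rightarrow> 'a strategy \<Rightarrow> real \<Rightarrow> real \<Rightarrow> 'a \<Rightarrow> real" where
  "price G t \<alpha> p s \<omega> = price_after G \<alpha> p \<omega> (card {n \<in> interventions G t \<alpha> \<omega>. fst \<alpha> n \<omega> \<le> s})"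

definition market_share :: "real \<Rightarrow> real \<Rightarrow> real \<Rightarrow> real" where
  "market_share \<Delta> p q =
     (if p - q \<le> - \<Delta> then 1 else if p - q < \<Delta> then - (p - q - \<Delta>) / (2 * \<Delta>) else 0)"

text \<open>Both the running gain \<open>f\<close> and the terminal gain \<open>g\<close>.\<close>

definition profit :: "'a duopoly \<Rightarrow> player \<Rightarrow> real \<Rightarrow> (player \<Rightarrow> real) \<Rightarrow> real" where
  "profit G i x y =
     min ((y i - x) * market_share (spread G) (y i) (y (other i))) (cap G i * x)"

text \<open>
  In \<open>gain G i t x y \<alpha> \<beta>\<close> and below, \<open>\<alpha>\<close> is the strategy of player \<open>i\<close> and \<open>\<beta>\<close> the one of
  player \<open>other i\<close>.
\<close>

definition prices :: "'a duopoly \<Rightarrow> player \<Rightarrow> real \<Rightarrow> (player \<Rightarrow> real) \<Rightarrow> 'a strategy \<Rightarrow> 'a strategy \<Rightarrow>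
    real \<Rightarrow> 'a \<Rightarrow> player \<Rightarrow> real" where
  "prices G i t y \<alpha> \<beta> s \<omega> k = price G t (if k = i then \<alpha> else \<beta>) (y k) s \<omega>"

type_synonym 'a gain_fn =
  "player \<Rightarrow> real \<Rightarrow> real \<Rightarrow> (player \<Rightarrow> real) \<Rightarrow> 'a strategy \<Rightarrow> 'a strategy \<Rightarrow> real"

definition gain :: "'a duopoly \<Rightarrow> 'a gain_fn" where
  "gain G i t x y \<alpha> \<beta> = (LINT \<omega>|prob_sp G.
     (LINT s:{t..horizon G}|lborel.
        exp (- discount G i * (s - t)) * profit G i (wholesale G t x s \<omega>) (prices G i t y \<alpha> \<beta> s \<omega>))
     - (\<Sum>k\<in>interventions G t \<alpha> \<omega>.
          exp (- discount G i * (fst \<alpha> k \<omega> - t)) * cost G i (price_after G \<alpha> (y i) \<omega> k) (snd \<alpha> k \<omega>))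
     + exp (- discount G i * (horizon G - t)) *
         profit G i (wholesale G t x (horizon G) \<omega>) (prices G i t y \<alpha> \<beta> (horizon G) \<omega>))"

definition perturbed_gain :: "'a duopoly \<Rightarrow> real \<Rightarrow> 'a gain_fn" where
  "perturbed_gain G \<kappa> i t x y \<alpha> \<beta> = gain G i t x y \<alpha> \<beta>
     - \<kappa> * (LINT \<omega>|prob_sp G. (\<Sum>k\<in>interventions G t \<beta> \<omega>. exp (- discount G i * (fst \<beta> k \<omega> - t))))"


section \<open>Best responses and value functions\<close>

text \<open>The best responses of player \<open>other i\<close> to the strategy \<open>\<alpha>\<close> of player \<open>i\<close>, for gains \<open>J\<close>.\<close>

definition best_responses :: "'a duopoly \<Rightarrow> 'a gain_fn \<Rightarrow> player \<Rightarrow> real \<Rightarrow> real \<Rightarrow> (player \<Rightarrow> real) \<Rightarrow>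
    'a strategy \<Rightarrow> 'a strategy set" where
  "best_responses G J i t x y \<alpha> = {\<beta> \<in> admissible G (other i) t.
     \<forall>\<beta>'\<in>admissible G (other i) t. J (other i) t x y \<beta>' \<alpha> \<le> J (other i) t x y \<beta> \<alpha>}"

text \<open>
  A response rule chooses ``the'' best response from the set of best responses. If that set is a
  singleton there is nothing to choose; otherwise the rule breaks the tie.
\<close>

type_synonym 'a response_rule =
  "player \<Rightarrow> real \<Rightarrow> real \<Rightarrow> (player \<Rightarrow> real) \<Rightarrow> 'a strategy \<Rightarrow> 'a strategy set \<Rightarrow> 'a strategy"

definition response_rule :: "'a response_rule \<Rightarrow> bool" where
  "response_rule R \<longleftrightarrow> (\<forall>i t x y \<alpha> B. B \<noteq> {} \<longrightarrow> R i t x y \<alpha> B \<in> B)"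

text \<open>
  The supremum is over the admissible strategies to which a best response exists, as the gain is
  defined only for these. If, as is implicit in speaking of the best response, it exists for every
  admissible strategy, then the supremum is over \<open>admissible G i t\<close>.
\<close>

definition value_for :: "'a duopoly \<Rightarrow> 'a gain_fn \<Rightarrow> 'a response_rule \<Rightarrow>
    player \<Rightarrow> real \<Rightarrow> real \<Rightarrow> (player \<Rightarrow> real) \<Rightarrow> ereal" where
  "value_for G J R i t x y =
     (SUP \<alpha>\<in>{\<alpha> \<in> admissible G i t. best_responses G J i t x y \<alpha> \<noteq> {}}.
        ereal (J i t x y \<alpha> (R i t x y \<alpha> (best_responses G J i t x y \<alpha>))))"

definition value_fn :: "'a duopoly \<Rightarrow> 'a response_rule \<Rightarrow> player \<Rightarrow> real \<Rightarrow> real \<Rightarrow> (player \<Rightarrow> real) \<Rightarrow> ereal"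
  where
  "value_fn G = value_for G (gain G)"

text \<open>
  In the perturbed game, best responses are with respect to the responder's perturbed gain. It
  differs from the unperturbed one by a term that depends on the opponent's strategy only, so
  maximising either of the two gains is the same.
\<close>

definition perturbed_value_fn :: "'a duopoly \<Rightarrow> 'a response_rule \<Rightarrow> real \<Rightarrow>
    player \<Rightarrow> real \<Rightarrow> real \<Rightarrow> (player \<Rightarrow> real) \<Rightarrow> ereal" where
  "perturbed_value_fn G R \<kappa> = value_for G (perturbed_gain G \<kappa>) R"

end

theory Submission
  imports Defs
begin

text \<open>
  The penalty in the gain of a player depends on the strategy of the opponent only, so it is a
  constant in the maximisation that defines the responder's best responses
  (\<open>best_responses_perturbed_gain\<close>). Every perturbed game therefore has the same best responses as
  the unperturbed one, and a response rule selects the same reply \<open>\<beta>\<close> to a strategy \<open>\<alpha>\<close> for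
  every \<open>\<kappa>\<close>.

  Consequently \<open>v\<^sub>\<kappa>\<close> is a supremum of the affine functions \<open>a \<alpha> - \<kappa> * b \<alpha>\<close> over a set that does not
  depend on \<open>\<kappa>\<close>, where \<open>a \<alpha>\<close> is the unperturbed gain against the reply and \<open>b \<alpha> \<ge> 0\<close> the expected
  discounted number of interventions of the reply. Such a supremum is nonincreasing in \<open>\<kappa>\<close>, and its
  limit at \<open>0\<close> is an exchange of two suprema: as \<open>\<kappa>\<close> decreases, each \<open>a \<alpha> - \<kappa> * b \<alpha>\<close> increases to
  \<open>a \<alpha>\<close>.
\<close>

lemma antimono_on_SUP_affine:
  fixes a b :: "'b \<Rightarrow> real"
  assumes "\<And>c. c \<in> A \<Longrightarrow> 0 \<le> b c"
  shows "antimono_on S (\<lambda>\<kappa>. SUP c\<in>A. ereal (a c - \<kappa> * b c))"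
proof (rule monotone_onI)
  fix \<kappa> \<kappa>' :: real
  assume "\<kappa> \<le> \<kappa>'"
  then show "(SUP c\<in>A. ereal (a c - \<kappa>' * b c)) \<le> (SUP c\<in>A. ereal (a c - \<kappa> * b c))"
    using assms by (intro SUP_mono) (force intro: mult_right_mono)
qed

text \<open>
  For \<open>\<kappa> > 0\<close> the values do not exceed the supremum at \<open>0\<close>, so only lower bounds matter, and for
  a lower bound a single near-optimal \<open>c\<close> can be fixed before \<open>\<kappa>\<close> tends to \<open>0\<close>.
\<close>

lemma tendsto_SUP_affine_at_right_0:
  fixes a b :: "'b \<Rightarrow> real"
  assumes b: "\<And>c. c \<in> A \<Longrightarrow> 0 \<le> b c"
  shows "((\<lambda>\<kappa>. SUP c\<in>A. ereal (a c - \<kappa> * b c)) \<longlongrightarrow> (SUP c\<in>A. ereal (a c))) (at_right 0)"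
proof (rule order_tendstoI)
  fix l
  assume "l < (SUP c\<in>A. ereal (a c))"
  then obtain c where c: "c \<in> A" "l < ereal (a c)"
    by (auto simp: less_SUP_iff)
  have "((\<lambda>\<kappa>. a c - \<kappa> * b c) \<longlongrightarrow> a c - 0 * b c) (at_right 0)"
    by (intro tendsto_intros)
  then have "((\<lambda>\<kappa>. ereal (a c - \<kappa> * b c)) \<longlongrightarrow> ereal (a c)) (at_right 0)"
    by simp
  then have "\<forall>\<^sub>F \<kappa> in at_right 0. l < ereal (a c - \<kappa> * b c)"
    using c(2) by (rule order_tendstoD(1))
  then show "\<forall>\<^sub>F \<kappa> in at_right 0. l < (SUP c\<in>A. ereal (a c - \<kappa> * b c))"
    by eventually_elim (use c(1) in \<open>auto simp: less_SUP_iff\<close>)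
next
  fix u
  assume u: "(SUP c\<in>A. ereal (a c)) < u"
  have "(SUP c\<in>A. ereal (a c - \<kappa> * b c)) \<le> (SUP c\<in>A. ereal (a c))" if "0 < \<kappa>" for \<kappa>
    using b that by (intro SUP_mono) force
  then show "\<forall>\<^sub>F \<kappa> in at_right 0. (SUP c\<in>A. ereal (a c - \<kappa> * b c)) < u"
    using u by (auto intro: eventually_mono[OF eventually_at_right_less] le_less_trans)
qed

text \<open>
  For the responder the roles are exchanged: the penalty counts the interventions of \<open>\<alpha>\<close>, hence
  cancels when two replies to \<open>\<alpha>\<close> are compared.
\<close>

lemma best_responses_perturbed_gain:
  "best_responses G (perturbed_gain G \<kappa>) i t x y \<alpha> = best_responses G (gain G) i t x y \<alpha>"
  by (simp add: best_responses_def perturbed_gain_def)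

theorem mainTheorem9:
  fixes G :: "'a duopoly" and R :: "'a response_rule" and i :: player
  assumes "duopoly G"
    and "response_rule R"
  shows "\<forall>t\<in>{0..horizon G}. \<forall>x\<ge>0. \<forall>y. (\<forall>k. 0 \<le> y k) \<longrightarrow>
           antimono_on {0<..} (\<lambda>\<kappa>. perturbed_value_fn G R \<kappa> i t x y) \<and>
           ((\<lambda>\<kappa>. perturbed_value_fn G R \<kappa> i t x y) \<longlongrightarrow> value_fn G R i t x y) (at_right 0)"
proof (intro ballI allI impI)
  fix t x :: real and y :: "player \<Rightarrow> real"
  define A where "A = {\<alpha> \<in> admissible G i t. best_responses G (gain G) i t x y \<alpha> \<noteq> {}}"
  define reply where "reply \<alpha> = R i t x y \<alpha> (best_responses G (gain G) i t x y \<alpha>)" for \<alpha>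
  define a where "a \<alpha> = gain G i t x y \<alpha> (reply \<alpha>)" for \<alpha>
  define b where "b \<alpha> = (LINT \<omega>|prob_sp G. (\<Sum>k\<in>interventions G t (reply \<alpha>) \<omega>.
      exp (- discount G i * (fst (reply \<alpha>) k \<omega> - t))))" for \<alpha>
  have b: "0 \<le> b \<alpha>" for \<alpha>
    unfolding b_def by (intro integral_nonneg_AE AE_I2 sum_nonneg) simp
  have v_kappa: "perturbed_value_fn G R \<kappa> i t x y = (SUP \<alpha>\<in>A. ereal (a \<alpha> - \<kappa> * b \<alpha>))" for \<kappa>
    unfolding perturbed_value_fn_def value_for_def best_responses_perturbed_gain
      perturbed_gain_def A_def a_def b_def reply_def ..
  have v: "value_fn G R i t x y = (SUP \<alpha>\<in>A. ereal (a \<alpha>))"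
    unfolding value_fn_def value_for_def A_def a_def reply_def ..
  show "antimono_on {0<..} (\<lambda>\<kappa>. perturbed_value_fn G R \<kappa> i t x y) \<and>
      ((\<lambda>\<kappa>. perturbed_value_fn G R \<kappa> i t x y) \<longlongrightarrow> value_fn G R i t x y) (at_right 0)"
    unfolding v_kappa v
    using antimono_on_SUP_affine[of A b] tendsto_SUP_affine_at_right_0[of A b] b by blast
qed

end
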